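(* Let $U$ be a finite universe, $\mathcal{F}=\uparrow(\mathcal{F}_+)\setminus\uparrow(\mathcal{F}_-)\subseteq 2^U$ an efficiently listable closure difference and $R$ a commutative ring with unit. Given a table $A\colon\mathcal{F}\to R$, the Zeta transform $\zeta A$ and the Möbius transform $\mu A$ can be computed in $\mathcal{O}(|\mathcal{F}||U|)$ ring operations and additional time $\mathcal{O}^*(|\mathcal{F}|)$.
   Context: $\uparrow(\mathcal{G})=\{S\subseteq U:\exists T\in\mathcal{G},T\subseteq S\}$; a closure difference is a family of the form $\uparrow(\mathcal{F}_+)\setminus\uparrow(\mathcal{F}_-)$. $\mathcal{F}$ is efficiently listable if some algorithm outputs all members of $\mathcal{F}$ (as bitstrings, in sorted order) in time $|\mathcal{F}||U|^{\mathcal{O}(1)}$; a table $\mathcal{F}\to R$ is given as the list of its values in that order. $\mathcal{O}^*(|\mathcal{F}|)$ means $|\mathcal{F}||U|^{\mathcal{O}(1)}$. $(\zeta A)(S)=\sum_{T\in\mathcal{F},T\subseteq S}A(T)$ and $(\mu A)(S)=\sum_{T\in\mathcal{F},T\subseteq S}(-1)^{|S\setminus T|}A(T)$ for $S\in\mathcal{F}$. *)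

theory Defs
  imports "HOL-Algebra.Ring" "HOL-Library.List_Lexorder" "HOL-Library.Log_Nat"
begin

definition up_closure :: "'u set \<Rightarrow> 'u set set \<Rightarrow> 'u set set" where
  "up_closure U G = {S. S \<subseteq> U \<and> (\<exists>T\<in>G. T \<subseteq> S)}"

definition zeta ::
  "('r, 'm) ring_scheme \<Rightarrow> 'u set set \<Rightarrow> ('u set \<Rightarrow> 'r) \<Rightarrow> 'u set \<Rightarrow> 'r" where
  "zeta R F A S = (\<Oplus>\<^bsub>R\<^esub>T\<in>{T \<in> F. T \<subseteq> S}. A T)"

definition moebius ::
  "('r, 'm) ring_scheme \<Rightarrow> 'u set set \<Rightarrow> ('u set \<Rightarrow> 'r) \<Rightarrow> 'u set \<Rightarrow> 'r" where
  "moebius R F A S =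
     (\<Oplus>\<^bsub>R\<^esub>T\<in>{T \<in> F. T \<subseteq> S}. ((\<ominus>\<^bsub>R\<^esub> \<one>\<^bsub>R\<^esub>) [^]\<^bsub>R\<^esub> card (S - T)) \<otimes>\<^bsub>R\<^esub> A T)"

text \<open>
  A universe is given as a duplicate-free list \<open>us\<close>; its order fixes the order of the
  positions of a bitstring. Bitstrings are compared lexicographically, with
  \<open>False < True\<close>.
\<close>

definition bitstring :: "'u list \<Rightarrow> 'u set \<Rightarrow> bool list" where
  "bitstring us S = map (\<lambda>u. u \<in> S) us"

definition listing :: "'u list \<Rightarrow> 'u set set \<Rightarrow> 'u set list" where
  "listing us F = sorted_key_list_of_set (bitstring us) F"

definition table :: "'u list \<Rightarrow> 'u set set \<Rightarrow> ('u set \<Rightarrow> 'r) \<Rightarrow> 'r list" where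
  "table us F A = map A (listing us F)"

text \<open>
  The machine has registers and finitely many (per program) arrays of natural numbers,
  and is charged logarithmic cost: each evaluated subexpression, in particular each
  address and each value read or written, costs one plus the number of its bits.
  The first argument of \<open>Arr\<close> and of \<open>Store\<close> is the name of an array, not an address.
\<close>

record state =
  reg :: "nat \<Rightarrow> nat"
  mem :: "nat \<Rightarrow> nat \<Rightarrow> nat"

datatype binop = Add | Sub | Mul | Quot | Lt | Eq

datatype nexp = Const nat | Reg nat | Arr nat nexp | Op binop nexp nexp

fun apply_binop :: "binop \<Rightarrow> nat \<Rightarrow> nat \<Rightarrow> nat" where
  "apply_binop Add x y = x + y"
| "apply_binop Sub x y = x - y"
| "apply_binop Mul x y = x * y"
| "apply_binop Quot x y = x div y"
| "apply_binop Lt x y = of_bool (x < y)"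
| "apply_binop Eq x y = of_bool (x = y)"

fun val :: "state \<Rightarrow> nexp \<Rightarrow> nat" where
  "val s (Const v) = v"
| "val s (Reg r) = reg s r"
| "val s (Arr a e) = mem s a (val s e)"
| "val s (Op f e1 e2) = apply_binop f (val s e1) (val s e2)"

abbreviation word_cost :: "nat \<Rightarrow> nat" where
  "word_cost v \<equiv> 1 + floorlog 2 v"

fun cost :: "state \<Rightarrow> nexp \<Rightarrow> nat" where
  "cost s (Const v) = word_cost v"
| "cost s (Reg r) = word_cost (reg s r)"
| "cost s (Arr a e) = cost s e + word_cost (val s (Arr a e))"
| "cost s (Op f e1 e2) = cost s e1 + cost s e2 + word_cost (val s (Op f e1 e2))"

datatype com =
    Skip
  | Assign nat nexp
  | Store nat nexp nexp
  | Seq com com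
  | Cond nexp com com
  | While nexp com

text \<open>\<open>exec c s t s'\<close>: started in \<open>s\<close>, program \<open>c\<close> halts in \<open>s'\<close> after time \<open>t\<close>.\<close>

inductive exec :: "com \<Rightarrow> state \<Rightarrow> nat \<Rightarrow> state \<Rightarrow> bool" where
  Skip: "exec Skip s 1 s"
| Assign: "exec (Assign r e) s (1 + cost s e) (s\<lparr>reg := (reg s)(r := val s e)\<rparr>)"
| Store: "exec (Store a i e) s (1 + cost s i + cost s e)
     (s\<lparr>mem := (mem s)(a := (mem s a)(val s i := val s e))\<rparr>)"
| Seq: "exec c1 s t1 s1 \<Longrightarrow> exec c2 s1 t2 s2 \<Longrightarrow> exec (Seq c1 c2) s (t1 + t2) s2"
| CondTrue: "val s b \<noteq> 0 \<Longrightarrow> exec c1 s t s' \<Longrightarrow> exec (Cond b c1 c2) s (1 + cost s b + t) s'"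
| CondFalse: "val s b = 0 \<Longrightarrow> exec c2 s t s' \<Longrightarrow> exec (Cond b c1 c2) s (1 + cost s b + t) s'"
| WhileFalse: "val s b = 0 \<Longrightarrow> exec (While b c) s (1 + cost s b) s"
| WhileTrue: "val s b \<noteq> 0 \<Longrightarrow> exec c s t1 s1 \<Longrightarrow> exec (While b c) s1 t2 s2 \<Longrightarrow>
     exec (While b c) s (1 + cost s b + t1 + t2) s2"

text \<open>
  An algebraic program additionally has arrays of ring elements. It is the same text for
  every ring, can only move ring elements and combine them by ring operations, and
  cannot test them. Ring operations are counted separately; the time counted for a ring
  instruction is that of computing the addresses involved.
\<close>

type_synonym 'r rmem = "nat \<Rightarrow> nat \<Rightarrow> 'r"

type_synonym cell = "nat \<times> nexp"  \<comment> \<open>array name, address\<close>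

datatype rop = RAdd | RSub | RMul

datatype acom =
    Plain com
  | RZero cell
  | ROne cell
  | Copy cell cell
  | ROp rop cell cell cell
  | ASeq acom acom
  | ACond nexp acom acom
  | AWhile nexp acom

fun apply_rop :: "('r, 'm) ring_scheme \<Rightarrow> rop \<Rightarrow> 'r \<Rightarrow> 'r \<Rightarrow> 'r" where
  "apply_rop R RAdd x y = x \<oplus>\<^bsub>R\<^esub> y"
| "apply_rop R RSub x y = x \<ominus>\<^bsub>R\<^esub> y"
| "apply_rop R RMul x y = x \<otimes>\<^bsub>R\<^esub> y"

definition get :: "state \<Rightarrow> 'r rmem \<Rightarrow> cell \<Rightarrow> 'r" where
  "get s m p = m (fst p) (val s (snd p))"

definition put :: "state \<Rightarrow> 'r rmem \<Rightarrow> cell \<Rightarrow> 'r \<Rightarrow> 'r rmem" where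
  "put s m p x = m(fst p := (m (fst p))(val s (snd p) := x))"

text \<open>
  \<open>aexec R c (s, m) q t (s', m')\<close>: started in \<open>(s, m)\<close>, program \<open>c\<close> halts in \<open>(s', m')\<close>
  after \<open>q\<close> ring operations and additional time \<open>t\<close>.
\<close>

inductive aexec :: "('r, 'm) ring_scheme \<Rightarrow> acom \<Rightarrow> state \<times> 'r rmem \<Rightarrow> nat \<Rightarrow> nat
    \<Rightarrow> state \<times> 'r rmem \<Rightarrow> bool" for R :: "('r, 'm) ring_scheme" where
  Plain: "exec c s t s' \<Longrightarrow> aexec R (Plain c) (s, m) 0 t (s', m)"
| RZero: "aexec R (RZero p) (s, m) 1 (1 + cost s (snd p)) (s, put s m p \<zero>\<^bsub>R\<^esub>)"
| ROne: "aexec R (ROne p) (s, m) 1 (1 + cost s (snd p)) (s, put s m p \<one>\<^bsub>R\<^esub>)"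
| Copy: "aexec R (Copy p p1) (s, m) 0 (1 + cost s (snd p) + cost s (snd p1))
     (s, put s m p (get s m p1))"
| ROp: "aexec R (ROp f p p1 p2) (s, m) 1
     (1 + cost s (snd p) + cost s (snd p1) + cost s (snd p2))
     (s, put s m p (apply_rop R f (get s m p1) (get s m p2)))"
| ASeq: "aexec R c1 (s, m) q1 t1 (s1, m1) \<Longrightarrow> aexec R c2 (s1, m1) q2 t2 (s2, m2) \<Longrightarrow>
     aexec R (ASeq c1 c2) (s, m) (q1 + q2) (t1 + t2) (s2, m2)"
| ACondTrue: "val s b \<noteq> 0 \<Longrightarrow> aexec R c1 (s, m) q t (s', m') \<Longrightarrow>
     aexec R (ACond b c1 c2) (s, m) q (1 + cost s b + t) (s', m')"
| ACondFalse: "val s b = 0 \<Longrightarrow> aexec R c2 (s, m) q t (s', m') \<Longrightarrow>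
     aexec R (ACond b c1 c2) (s, m) q (1 + cost s b + t) (s', m')"
| AWhileFalse: "val s b = 0 \<Longrightarrow> aexec R (AWhile b c) (s, m) 0 (1 + cost s b) (s, m)"
| AWhileTrue: "val s b \<noteq> 0 \<Longrightarrow> aexec R c (s, m) q1 t1 (s1, m1) \<Longrightarrow>
     aexec R (AWhile b c) (s1, m1) q2 t2 (s2, m2) \<Longrightarrow>
     aexec R (AWhile b c) (s, m) (q1 + q2) (1 + cost s b + t1 + t2) (s2, m2)"

text \<open>
  Running times are asymptotic, so they concern a class \<open>X\<close> of instances rather than a
  single family. An instance is a word \<open>x\<close> describing in an arbitrary way a universe
  \<open>us x\<close> and a family \<open>F x\<close> of its subsets; every program is given the
  word and the size of the universe.
\<close>

definition input_state :: "nat \<Rightarrow> bool list \<Rightarrow> state" where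
  "input_state n x =
     \<lparr>reg = (\<lambda>_. 0)(0 := n, 1 := length x),
      mem = (\<lambda>_ _. 0)(0 := (\<lambda>i. if i < length x then of_bool (x ! i) else 0))\<rparr>"

definition input_rmem :: "('r, 'm) ring_scheme \<Rightarrow> 'r list \<Rightarrow> 'r rmem" where
  "input_rmem R tbl =
     (\<lambda>_ _. \<zero>\<^bsub>R\<^esub>)(0 := (\<lambda>i. if i < length tbl then tbl ! i else \<zero>\<^bsub>R\<^esub>))"

text \<open>
  The output of a listing program is a list of \<open>k\<close> bitstrings of length \<open>n\<close>, stored as
  the numbers \<open>n\<close> and \<open>k\<close> and one array holding the bitstrings one after the other.
\<close>

definition outputs_bitstrings :: "state \<Rightarrow> nat \<Rightarrow> bool list list \<Rightarrow> bool" where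
  "outputs_bitstrings s n bs \<longleftrightarrow>
     reg s 0 = n \<and> reg s 1 = length bs \<and>
     (\<forall>i < length bs. \<forall>j < n. mem s 0 (i * n + j) = of_bool (bs ! i ! j))"

definition outputs_table :: "'r rmem \<Rightarrow> 'r list \<Rightarrow> bool" where
  "outputs_table m tbl \<longleftrightarrow> (\<forall>i < length tbl. m 0 i = tbl ! i)"

text \<open>
  The bound \<open>c |F| |U|\<^sup>k\<close>. No program halts in time \<open>0\<close>, so an empty family or an
  empty universe is counted as having size one.
\<close>

definition ostar_bound :: "nat \<Rightarrow> nat \<Rightarrow> 'u set \<Rightarrow> 'u set set \<Rightarrow> nat" where
  "ostar_bound c k U F = c * max 1 (card F) * max 1 (card U) ^ k"

definition efficiently_listable ::
  "bool list set \<Rightarrow> (bool list \<Rightarrow> 'u list) \<Rightarrow> (bool list \<Rightarrow> 'u set set) \<Rightarrow> bool" where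
  "efficiently_listable X us F \<longleftrightarrow>
     (\<exists>L c k. \<forall>x\<in>X. \<exists>t s.
        exec L (input_state (length (us x)) x) t s \<and>
        outputs_bitstrings s (length (us x)) (map (bitstring (us x)) (listing (us x) (F x))) \<and>
        t \<le> ostar_bound c k (set (us x)) (F x))"

text \<open>
  One program and one choice of the constants \<open>d\<close>, \<open>c\<close>, \<open>k\<close> serve all instances, all
  commutative rings with elements in \<open>'r\<close> (the zero ring included), and all tables. The
  table is input and output as the list of its values in the order of the listing.
\<close>

definition transform_computable ::
  "bool list set \<Rightarrow> (bool list \<Rightarrow> 'u list) \<Rightarrow> (bool list \<Rightarrow> 'u set set) \<Rightarrow>
   ('r ring \<Rightarrow> 'u set set \<Rightarrow> ('u set \<Rightarrow> 'r) \<Rightarrow> 'u set \<Rightarrow> 'r) \<Rightarrow> bool" where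
  "transform_computable X us F transform \<longleftrightarrow>
     (\<exists>P d c k. \<forall>x\<in>X. \<forall>R :: 'r ring. cring R \<longrightarrow> (\<forall>A \<in> F x \<rightarrow> carrier R.
        \<exists>q t s m.
          aexec R P (input_state (length (us x)) x, input_rmem R (table (us x) (F x) A))
            q t (s, m) \<and>
          outputs_table m (table (us x) (F x) (transform R (F x) A)) \<and>
          q \<le> d * (card (F x) * card (set (us x))) \<and>
          t \<le> ostar_bound c k (set (us x)) (F x)))"

end

theory Submission
  imports Defs "HOL-Library.Nat_Bijection"
begin

text \<open>
  This is Yates's algorithm restricted to \<open>F\<close>. Write \<open>V\<close> for the first \<open>j\<close> elements of the
  universe. The entry of \<open>S\<close> after \<open>j\<close> sweeps is the sum over the members \<open>T \<subseteq> S\<close> of \<open>F\<close>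
  with \<open>S - T \<subseteq> V\<close>, where \<open>T\<close> has the weight \<open>e\<close> to the power of the cardinality of
  \<open>S - T\<close>, with \<open>e = 1\<close> for Zeta and \<open>e = -1\<close> for Moebius. The sweep for an element \<open>u\<close> of
  \<open>S\<close> adds \<open>e\<close> times the entry of \<open>S - {u}\<close>. A closure difference is convex, so if
  \<open>S - {u}\<close> is not in \<open>F\<close>, then no member of \<open>F\<close> below \<open>S\<close> avoids \<open>u\<close> and nothing has to be
  added: a single ring operation per set and element suffices. The position of \<open>S - {u}\<close> in
  the listing is looked up in an array addressed by codes of sets, which have only as many
  bits as the universe has elements.
\<close>

subsection \<open>Expressions with bounded values\<close>

text \<open>Logarithmic cost is charged at every subexpression, so a bound on the final value alone
  would not control it; addresses count as well as array contents.\<close>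

fun vals_le :: "nat \<Rightarrow> state \<Rightarrow> nexp \<Rightarrow> bool" where
  "vals_le b s (Const v) \<longleftrightarrow> v \<le> b"
| "vals_le b s (Reg r) \<longleftrightarrow> reg s r \<le> b"
| "vals_le b s (Arr a e) \<longleftrightarrow> vals_le b s e \<and> val s (Arr a e) \<le> b"
| "vals_le b s (Op f e1 e2) \<longleftrightarrow> vals_le b s e1 \<and> vals_le b s e2 \<and> val s (Op f e1 e2) \<le> b"

fun nodes :: "nexp \<Rightarrow> nat" where
  "nodes (Const v) = 1"
| "nodes (Reg r) = 1"
| "nodes (Arr a e) = nodes e + 1"
| "nodes (Op f e1 e2) = nodes e1 + nodes e2 + 1"

text \<open>A family of subsets of an \<open>n\<close>-element universe has at most \<open>2 ^ n\<close> members, so all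
  numbers occurring in the algorithm are at most the following one.\<close>

definition max_word :: "nat \<Rightarrow> nat" where
  "max_word n = 2 * 4 ^ n"

text \<open>\<open>max_word n\<close> equals \<open>2 ^ (2 * n + 1)\<close> and has
  \<open>2 * n + 2\<close> bits; every evaluated value is charged one more.\<close>

definition max_cost :: "nat \<Rightarrow> nat" where
  "max_cost n = 2 * n + 3"

lemma max_cost_pos: "0 < max_cost n"
  by (simp add: max_cost_def)

lemma word_cost_le: "v \<le> max_word n \<Longrightarrow> word_cost v \<le> max_cost n"
proof -
  assume "v \<le> max_word n"
  also have "max_word n = 2 ^ (2 * n + 1)"
    by (simp add: max_word_def power_mult)
  also have "\<dots> < 2 ^ (2 * n + 2)"
    by (rule power_strict_increasing) simp_all
  finally show ?thesis
    using floorlog_leI[of v 2 "2 * n + 2"] by (simp add: max_cost_def)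
qed

lemma cost_le: "vals_le (max_word n) s e \<Longrightarrow> cost s e \<le> nodes e * max_cost n"
proof (induction e)
  case (Arr a e)
  then show ?case
    using word_cost_le[of "mem s a (val s e)" n] by simp
next
  case (Op f e1 e2)
  then show ?case
    using word_cost_le[of "apply_binop f (val s e1) (val s e2)" n]
    by (simp add: add_mult_distrib)
qed (use word_cost_le in auto)


subsection \<open>Weakest preconditions\<close>

text \<open>Total correctness: some halting run exists. The postcondition also receives both
  resource counts, so that the rules below add them up along a program.\<close>

definition wp :: "('r, 'm) ring_scheme \<Rightarrow> acom \<Rightarrow> (nat \<Rightarrow> nat \<Rightarrow> state \<Rightarrow> 'r rmem \<Rightarrow> bool)
    \<Rightarrow> state \<Rightarrow> 'r rmem \<Rightarrow> bool" where
  "wp R c Q s m \<longleftrightarrow> (\<exists>q t s' m'. aexec R c (s, m) q t (s', m') \<and> Q q t s' m')"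

lemma wp_mono:
  assumes "wp R c Q s m" "\<And>q t s' m'. Q q t s' m' \<Longrightarrow> Q' q t s' m'"
  shows "wp R c Q' s m"
  using assms unfolding wp_def by blast

lemma wp_Plain: "exec c s t s' \<Longrightarrow> Q 0 t s' m \<Longrightarrow> wp R (Plain c) Q s m"
  unfolding wp_def by (blast intro: aexec.Plain)

lemma wp_Skip: "Q 0 1 s m \<Longrightarrow> wp R (Plain Skip) Q s m"
  by (rule wp_Plain[OF exec.Skip])

text \<open>Time is measured in units of \<open>max_cost n\<close>: one per expression node and one
  for the instruction. Bounding running times then amounts to counting nodes.\<close>

lemma wp_Assign:
  assumes "vals_le (max_word n) s e"
    and "\<And>t. t \<le> (nodes e + 1) * max_cost n \<Longrightarrow>
      Q 0 t (s\<lparr>reg := (reg s)(r := val s e)\<rparr>) m"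
  shows "wp R (Plain (Assign r e)) Q s m"
  by (rule wp_Plain[OF exec.Assign], rule assms(2))
    (use cost_le[OF assms(1)] max_cost_pos[of n] in simp)

lemma wp_Store:
  assumes "vals_le (max_word n) s i" "vals_le (max_word n) s e"
    and "\<And>t. t \<le> (nodes i + nodes e + 1) * max_cost n \<Longrightarrow>
      Q 0 t (s\<lparr>mem := (mem s)(a := (mem s a)(val s i := val s e))\<rparr>) m"
  shows "wp R (Plain (Store a i e)) Q s m"
  by (rule wp_Plain[OF exec.Store], rule assms(3))
    (use cost_le[OF assms(1)] cost_le[OF assms(2)] max_cost_pos[of n] in
      \<open>simp add: add_mult_distrib\<close>)

lemma wp_ROp:
  assumes "vals_le (max_word n) s (snd p)" "vals_le (max_word n) s (snd p1)"
    "vals_le (max_word n) s (snd p2)"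
    and "\<And>t. t \<le> (nodes (snd p) + nodes (snd p1) + nodes (snd p2) + 1) * max_cost n \<Longrightarrow>
      Q 1 t s (put s m p (apply_rop R f (get s m p1) (get s m p2)))"
  shows "wp R (ROp f p p1 p2) Q s m"
proof -
  have "1 + cost s (snd p) + cost s (snd p1) + cost s (snd p2)
      \<le> (nodes (snd p) + nodes (snd p1) + nodes (snd p2) + 1) * max_cost n"
    using cost_le[OF assms(1)] cost_le[OF assms(2)] cost_le[OF assms(3)] max_cost_pos[of n]
    by (simp add: add_mult_distrib)
  from assms(4)[OF this] show ?thesis
    unfolding wp_def by (blast intro: aexec.ROp)
qed

lemma wp_Seq:
  assumes "wp R c1 (\<lambda>q1 t1. wp R c2 (\<lambda>q2 t2. Q (q1 + q2) (t1 + t2))) s m"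
  shows "wp R (ASeq c1 c2) Q s m"
  using assms unfolding wp_def by (blast intro: aexec.ASeq)

lemma wp_Cond:
  assumes "vals_le (max_word n) s b"
    and "\<And>t'. t' \<le> (nodes b + 1) * max_cost n \<Longrightarrow> val s b \<noteq> 0 \<Longrightarrow>
      wp R c1 (\<lambda>q t. Q q (t' + t)) s m"
    and "\<And>t'. t' \<le> (nodes b + 1) * max_cost n \<Longrightarrow> val s b = 0 \<Longrightarrow>
      wp R c2 (\<lambda>q t. Q q (t' + t)) s m"
  shows "wp R (ACond b c1 c2) Q s m"
proof -
  have t': "1 + cost s b \<le> (nodes b + 1) * max_cost n"
    using cost_le[OF assms(1)] max_cost_pos[of n] by simp
  show ?thesis
  proof (cases "val s b = 0")
    case True
    with assms(3)[OF t'] show ?thesis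
      unfolding wp_def by (blast intro: aexec.ACondFalse)
  next
    case False
    with assms(2)[OF t'] show ?thesis
      unfolding wp_def by (blast intro: aexec.ACondTrue)
  qed
qed

abbreviation For :: "nat \<Rightarrow> nat \<Rightarrow> acom \<Rightarrow> acom" where
  "For r b c \<equiv> ASeq (Plain (Assign r (Const 0)))
     (AWhile (Op Lt (Reg r) (Reg b)) (ASeq c (Plain (Assign r (Op Add (Reg r) (Const 1))))))"

text \<open>The invariant is stated for the state with the counter already set, and it must fix the
  limit register, which every guard reads again. Guard and increment take 4 units each, hence 8 per
  round; the extra round in \<open>N + 1\<close> pays for the initialization and the failing
  guard.\<close>

lemma wp_For:
  assumes N: "N \<le> max_word n"
    and start: "I 0 (s\<lparr>reg := (reg s)(r := 0)\<rparr>) m"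
    and bound: "\<And>i s m. I i s m \<Longrightarrow> reg s b = N"
    and step: "\<And>i s m. i < N \<Longrightarrow> reg s r = i \<Longrightarrow> I i s m \<Longrightarrow>
      wp R c (\<lambda>q t s' m'. q \<le> qb \<and> t \<le> tb \<and> reg s' r = i \<and>
        I (Suc i) (s'\<lparr>reg := (reg s')(r := Suc i)\<rparr>) m') s m"
    and final: "\<And>q t s' m'. q \<le> N * qb \<Longrightarrow> t \<le> (N + 1) * (tb + 8 * max_cost n) \<Longrightarrow>
      I N s' m' \<Longrightarrow> Q q t s' m'"
  shows "wp R (For r b c) Q s m"
proof -
  let ?w = "max_cost n"
  let ?g = "Op Lt (Reg r) (Reg b)"
  let ?body = "ASeq c (Plain (Assign r (Op Add (Reg r) (Const 1))))"
  have max_word: "1 \<le> max_word n"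
    by (simp add: max_word_def)
  have guard: "1 + cost s ?g \<le> 4 * ?w" if "reg s r \<le> N" "reg s b = N" for s
  proof -
    have "vals_le (max_word n) s ?g"
      using that N max_word by (simp add: of_bool_def)
    from cost_le[OF this] show ?thesis
      using max_cost_pos[of n] by (simp del: cost.simps)
  qed
  \<comment> \<open>Induction on the number \<open>d\<close> of remaining rounds; the separate
    \<open>4 * ?w\<close> is for the guard that ends the loop.\<close>
  have loop: "\<exists>q t s' m'. aexec R (AWhile ?g ?body) (s, m) q t (s', m') \<and>
      q \<le> d * qb \<and> t \<le> d * (tb + 8 * ?w) + 4 * ?w \<and> I N s' m'"
    if "d = N - i" "i \<le> N" "reg s r = i" "I i s m" for d i s m
    using that
  proof (induction d arbitrary: i s m)
    case 0
    then have "val s ?g = 0" "I N s m"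
      using bound by auto
    then show ?case
      using aexec.AWhileFalse[of s ?g R ?body m] guard[of s] 0 bound by auto
  next
    case (Suc d)
    then have i: "i < N" "val s ?g \<noteq> 0"
      using bound by auto
    obtain q1 t1 s1 m1 where c: "aexec R c (s, m) q1 t1 (s1, m1)" "q1 \<le> qb" "t1 \<le> tb"
      "reg s1 r = i" "I (Suc i) (s1\<lparr>reg := (reg s1)(r := Suc i)\<rparr>) m1"
      using step[OF i(1) Suc.prems(3,4)] unfolding wp_def by blast
    let ?inc = "Op Add (Reg r) (Const 1)"
    let ?s2 = "s1\<lparr>reg := (reg s1)(r := Suc i)\<rparr>"
    have "aexec R (Plain (Assign r ?inc)) (s1, m1) 0 (1 + cost s1 ?inc) (?s2, m1)"
      using aexec.Plain[OF exec.Assign[of r ?inc s1]] c(4) by simp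
    from aexec.ASeq[OF c(1) this]
    have body: "aexec R ?body (s, m) q1 (t1 + (1 + cost s1 ?inc)) (?s2, m1)"
      by simp
    have inc: "1 + cost s1 ?inc \<le> 4 * ?w"
      using cost_le[of n s1 ?inc] c(4) i N max_word max_cost_pos[of n] by simp
    obtain q2 t2 s' m' where rest: "aexec R (AWhile ?g ?body) (?s2, m1) q2 t2 (s', m')"
      "q2 \<le> d * qb" "t2 \<le> d * (tb + 8 * ?w) + 4 * ?w" "I N s' m'"
    proof -
      have "d = N - Suc i" "Suc i \<le> N" "reg ?s2 r = Suc i"
        using Suc.prems(1) i(1) by simp_all
      from Suc.IH[OF this c(5)] show ?thesis
        using that by blast
    qed
    have "1 + cost s ?g \<le> 4 * ?w"
      using guard Suc.prems bound by blast
    then have "1 + cost s ?g + (t1 + (1 + cost s1 ?inc)) + t2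
        \<le> Suc d * (tb + 8 * ?w) + 4 * ?w"
      using inc rest(3) c(3) by simp
    moreover have "q1 + q2 \<le> Suc d * qb"
      using c(2) rest(2) by simp
    ultimately show ?case
      using aexec.AWhileTrue[OF i(2) body rest(1)] rest(4) by blast
  qed
  let ?s0 = "s\<lparr>reg := (reg s)(r := 0)\<rparr>"
  obtain q t s' m' where "aexec R (AWhile ?g ?body) (?s0, m) q t (s', m')"
      "q \<le> N * qb" "t \<le> N * (tb + 8 * ?w) + 4 * ?w" "I N s' m'"
    using loop[of N 0 ?s0 m] start by auto
  moreover have "aexec R (Plain (Assign r (Const 0))) (s, m) 0 (1 + cost s (Const 0)) (?s0, m)"
    using aexec.Plain[OF exec.Assign[of r "Const 0" s]] by simp
  moreover have "1 + cost s (Const 0) \<le> 2 * ?w"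
    using cost_le[of n s "Const 0"] max_cost_pos[of n] by simp
  ultimately have "aexec R (For r b c) (s, m) (0 + q) (1 + cost s (Const 0) + t) (s', m')"
    "0 + q \<le> N * qb" "1 + cost s (Const 0) + t \<le> (N + 1) * (tb + 8 * ?w)" "I N s' m'"
    by (blast intro: aexec.ASeq, simp_all)
  then show ?thesis
    unfolding wp_def using final by blast
qed

subsection \<open>The transform of an indexed family\<close>

text \<open>Register 0 holds \<open>n\<close>, register 3 the number of a set and register 2 that of
  an element; the address follows the row layout in which the listing program leaves its
  bitstrings.\<close>

definition bit_expr :: nexp where
  "bit_expr = Arr 0 (Op Add (Op Mul (Reg 3) (Reg 0)) (Reg 2))"

text \<open>Array 1 receives the codes of the sets, where a set of positions is coded by the
  sum of the powers \<open>2 ^ j\<close> over its elements \<open>j\<close>; register 4 holds \<open>2 ^ j\<close>.\<close>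

definition encode_set :: acom where
  "encode_set = For 2 0 (ASeq (Plain (Assign 5 (Op Add (Reg 5) (Op Mul bit_expr (Reg 4)))))
     (Plain (Assign 4 (Op Mul (Const 2) (Reg 4)))))"

definition encode_sets :: acom where
  "encode_sets = For 3 1
     (ASeq (Plain (Assign 5 (Const 0))) (ASeq (Plain (Assign 4 (Const 1)))
       (ASeq encode_set (Plain (Store 1 (Reg 3) (Reg 5))))))"

text \<open>Array 2 is a dictionary from codes to indices. The cells to be looked up may hold
  anything, hence they are first filled with the number of sets, which serves as a dummy
  index.\<close>

definition clear_dict :: acom where
  "clear_dict = For 3 1 (Plain (Store 2 (Op Sub (Arr 1 (Reg 3)) (Reg 4)) (Reg 1)))"

definition fill_dict :: acom where
  "fill_dict = For 3 1 (Plain (Store 2 (Arr 1 (Reg 3)) (Reg 3)))"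

text \<open>Removing \<open>j\<close> lowers the code by \<open>2 ^ j\<close>, so the smaller set is
  found by arithmetic. If it is missing, the dummy index leads to a cell that holds zero, which
  avoids a further test.\<close>

definition update :: "rop \<Rightarrow> acom" where
  "update f = For 3 1 (ACond bit_expr
     (ROp f (0, Reg 3) (0, Reg 3) (0, Arr 2 (Op Sub (Arr 1 (Reg 3)) (Reg 4)))) (Plain Skip))"

text \<open>Clearing all \<open>2 ^ n\<close> codes could exceed the time bound, so each sweep
  clears one cell per set. This may destroy entries of earlier sweeps, hence the refilling.\<close>

definition transform_loop :: "rop \<Rightarrow> acom" where
  "transform_loop f = ASeq (Plain (Assign 4 (Const 1)))
     (For 2 0 (ASeq clear_dict (ASeq fill_dict (ASeq (update f)
       (Plain (Assign 4 (Op Mul (Const 2) (Reg 4))))))))"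

text \<open>The family as the machine sees it: members are numbered, and elements of the universe
  are replaced by their positions.\<close>

locale indexed_family =
  fixes n k :: nat and D :: "nat \<Rightarrow> nat set"
  assumes D_subset: "i < k \<Longrightarrow> D i \<subseteq> {..<n}"
    and D_inj: "inj_on D {..<k}"
begin

text \<open>The disjunct \<open>p = k\<close> guarantees a minimum and makes \<open>k\<close> the
  answer for a missing set.\<close>

definition index :: "nat set \<Rightarrow> nat" where
  "index X = (LEAST p. p = k \<or> D p = X)"

lemma index_le: "index X \<le> k"
  unfolding index_def by (rule Least_le) simp

lemma index_cases: "index X = k \<or> D (index X) = X"
  unfolding index_def by (rule LeastI[of _ k]) simp

lemma index_D:
  assumes "p < k"
  shows "index (D p) = p"
proof -
  have "index (D p) \<le> p"
    unfolding index_def by (rule Least_le) simp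
  then have "index (D p) < k" "D (index (D p)) = D p"
    using assms index_cases[of "D p"] by auto
  then show ?thesis
    using assms D_inj by (auto dest: inj_onD)
qed

lemma index_absent: "(\<And>p. p < k \<Longrightarrow> D p \<noteq> X) \<Longrightarrow> index X = k"
  using index_cases[of X] index_le[of X] by (auto simp: le_less)

text \<open>Machine-free description of ring array 0 after \<open>j\<close> sweeps. Each sweep reads
  only values from before it, and the dummy entry \<open>k\<close> never changes.\<close>

primrec sweep :: "('r, 'm) ring_scheme \<Rightarrow> rop \<Rightarrow> (nat \<Rightarrow> 'r) \<Rightarrow> nat \<Rightarrow> nat \<Rightarrow> 'r" where
  "sweep R f v 0 = v"
| "sweep R f v (Suc j) = (\<lambda>i. if i < k \<and> j \<in> D i
     then apply_rop R f (sweep R f v j i) (sweep R f v j (index (D i - {j})))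
     else sweep R f v j i)"

section \<open>Sizes of the numbers in registers and arrays\<close>

lemma finite_D: "i < k \<Longrightarrow> finite (D i)"
  using D_subset finite_subset by blast

lemma k_le: "k \<le> 2 ^ n"
proof -
  have "card (D ` {..<k}) \<le> card (Pow {..<n})"
    using D_subset by (intro card_mono) auto
  then show ?thesis
    using D_inj by (simp add: card_image card_Pow)
qed

lemma pow_le: "2 * 2 ^ n \<le> max_word n"
  by (simp add: max_word_def power_mono)

lemma fits:
  "0 < max_word n" "Suc 0 \<le> max_word n" "2 \<le> max_word n" "n \<le> max_word n" "k \<le> max_word n"
proof -
  have "n < 2 ^ n" by (rule less_exp)
  moreover have "(1::nat) \<le> 2 ^ n" by simp
  ultimately show "0 < max_word n" "Suc 0 \<le> max_word n" "2 \<le> max_word n" "n \<le> max_word n"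
    "k \<le> max_word n"
    using pow_le k_le by linarith+
qed

text \<open>At most \<open>2 ^ n\<close> rows of width \<open>n < 2 ^ n\<close> keep the bit
  addresses within \<open>4 ^ n\<close>, which explains the base 4 in
  \<open>max_word\<close>.\<close>

lemma address_fits:
  assumes "i < k" "j < n"
  shows "i * n + j \<le> max_word n" "i * n \<le> max_word n"
proof -
  have "i * n + j \<le> Suc i * n"
    using assms by simp
  also have "\<dots> \<le> 2 ^ n * 2 ^ n"
    using assms k_le less_exp[of n] by (intro mult_mono) auto
  also have "\<dots> = 4 ^ n"
    by (simp flip: power_mult_distrib)
  finally show "i * n + j \<le> max_word n" "i * n \<le> max_word n"
    by (simp_all add: max_word_def)
qed

lemma set_encode_less:
  assumes "X \<subseteq> {..<n}"
  shows "set_encode X < 2 ^ n"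
proof -
  have "set_encode X \<le> set_encode {..<n}"
    using assms unfolding set_encode_def by (intro sum_mono2) auto
  also have "\<dots> < 2 ^ n"
    by (simp add: set_encode_def lessThan_atLeast0 sum_power2)
  finally show ?thesis .
qed

lemma power_fits:
  assumes "j < n"
  shows "2 ^ j \<le> max_word n" "2 * 2 ^ j \<le> max_word n"
proof -
  have "(2::nat) ^ j \<le> 2 ^ n"
    using assms by simp
  then show "2 ^ j \<le> max_word n" "2 * 2 ^ j \<le> max_word n"
    using pow_le by linarith+
qed

lemma code_fits: "X \<subseteq> {..<n} \<Longrightarrow> set_encode X \<le> max_word n"
  using set_encode_less[of X] pow_le by linarith

text \<open>The effect of one round of \<open>encode_set\<close> on register 5.\<close>

lemma set_encode_Int_lessThan_Suc:
  "set_encode (X \<inter> {..<Suc j}) = set_encode (X \<inter> {..<j}) + of_bool (j \<in> X) * 2 ^ j"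
proof (cases "j \<in> X")
  case True
  then have "X \<inter> {..<Suc j} = insert j (X \<inter> {..<j})"
    by auto
  then show ?thesis
    using True by simp
next
  case False
  then have "X \<inter> {..<Suc j} = X \<inter> {..<j}"
    by (auto simp: less_Suc_eq)
  then show ?thesis
    using False by simp
qed

text \<open>Formulated for register and array contents rather than states, so that the index written
  to decides whether the fact survives an update.\<close>

definition input :: "(nat \<Rightarrow> nat) \<Rightarrow> (nat \<Rightarrow> nat \<Rightarrow> nat) \<Rightarrow> bool" where
  "input g h \<longleftrightarrow> g 0 = n \<and> g 1 = k \<and> (\<forall>i<k. \<forall>j<n. h 0 (i * n + j) = of_bool (j \<in> D i))"

definition coded :: "(nat \<Rightarrow> nat) \<Rightarrow> (nat \<Rightarrow> nat \<Rightarrow> nat) \<Rightarrow> bool" where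
  "coded g h \<longleftrightarrow> input g h \<and> (\<forall>i<k. h 1 i = set_encode (D i))"

lemma input_upd [simp]:
  "1 < r \<Longrightarrow> input (g(r := x)) h = input g h"
  "0 < a \<Longrightarrow> input g (h(a := y)) = input g h"
  by (simp_all add: input_def)

lemma coded_upd [simp]:
  "1 < r \<Longrightarrow> coded (g(r := x)) h = coded g h"
  "1 < a \<Longrightarrow> coded g (h(a := y)) = coded g h"
  by (simp_all add: coded_def)

lemma inputD:
  assumes "input g h"
  shows "g 0 = n" "g 1 = k" "g (Suc 0) = k"
    "i < k \<Longrightarrow> j < n \<Longrightarrow> h 0 (i * n + j) = of_bool (j \<in> D i)"
  using assms by (simp_all add: input_def)

lemma codedD:
  assumes "coded g h"
  shows "input g h" "i < k \<Longrightarrow> h 1 i = set_encode (D i)" "i < k \<Longrightarrow> h (Suc 0) i = set_encode (D i)"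
  using assms by (simp_all add: coded_def)

section \<open>Correctness and cost of the individual loops\<close>

lemma wp_encode_set:
  assumes "input (reg s) (mem s)" "reg s 3 = i" "reg s 4 = 1" "reg s 5 = 0" "i < k"
  shows "wp R encode_set (\<lambda>q t s' m'. q = 0 \<and> t \<le> (n + 1) * (23 * max_cost n) \<and>
    input (reg s') (mem s') \<and> reg s' 3 = i \<and> reg s' 5 = set_encode (D i) \<and> mem s' 1 = mem s 1 \<and> m' = m) s m"
  unfolding encode_set_def
\<comment> \<open>The assigned expressions have 10 and 3 nodes; with one unit per instruction this
  makes 15, and the loop overhead of 8 leads to 23.\<close>
proof (rule wp_For[where n = n and N = n and qb = 0 and tb = "15 * max_cost n" and
      I = "\<lambda>j s' m'. input (reg s') (mem s') \<and> reg s' 3 = i \<and> reg s' 5 = set_encode (D i \<inter> {..<j}) \<and>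
        reg s' 4 = 2 ^ j \<and> mem s' 1 = mem s 1 \<and> m' = m"], goal_cases)
  case (4 j s1 m1)
  then have j: "j < n" "reg s1 0 = n" "mem s1 0 (i * n + j) = of_bool (j \<in> D i)"
    using assms(5) inputD[of "reg s1" "mem s1"] by simp_all
  have "set_encode (D i \<inter> {..<j}) \<le> max_word n"
    "set_encode (D i \<inter> {..<j}) + of_bool (j \<in> D i) * 2 ^ j \<le> max_word n"
    unfolding set_encode_Int_lessThan_Suc[symmetric]
    using D_subset[OF assms(5)] by (intro code_fits; blast)+
  moreover have "i \<le> max_word n" "j \<le> max_word n"
    using j(1) assms(5) fits by linarith+
  moreover have "of_bool (j \<in> D i) * (2::nat) ^ j \<le> max_word n"
    "of_bool (j \<in> D i) \<le> max_word n"
    using power_fits[OF j(1)] fits by auto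
  ultimately show ?case
    using 4 j(2,3) fits power_fits[OF j(1)] address_fits[OF assms(5) j(1)]
    by (intro wp_Seq wp_Assign[where n = n])
      (simp_all add: bit_expr_def set_encode_Int_lessThan_Suc)
next
  case (5 q t s' m')
  moreover have "D i \<inter> {..<n} = D i"
    using D_subset[OF assms(5)] by blast
  ultimately show ?case
    by (simp add: algebra_simps)
qed (use assms fits in \<open>auto dest: inputD\<close>)

lemma wp_encode_sets:
  assumes "input (reg s) (mem s)"
  shows "wp R encode_sets (\<lambda>q t s' m'. q = 0 \<and>
    t \<le> (n + 1) * (k + 1) * (38 * max_cost n) \<and> coded (reg s') (mem s') \<and> m' = m) s m"
  unfolding encode_sets_def
\<comment> \<open>Two initial assignments (4 units), the inner loop (\<open>23 * (n + 1)\<close>)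
  and the store (3) fit into \<open>30 * (n + 1)\<close>.\<close>
proof (rule wp_For[where n = n and N = k and qb = 0 and tb = "(n + 1) * (30 * max_cost n)" and
      I = "\<lambda>i s' m'. input (reg s') (mem s') \<and> (\<forall>p<i. mem s' 1 p = set_encode (D p)) \<and> m' = m"], goal_cases)
  case (4 i s1 m1)
  then have i: "i < k" "reg s1 3 = i" and inv: "input (reg s1) (mem s1)" "\<forall>p<i. mem s1 1 p = set_encode (D p)"
    "m1 = m"
    by auto
  have fits': "i \<le> max_word n" "set_encode (D i) \<le> max_word n"
    using i fits code_fits D_subset by auto
  show ?case
    apply (rule wp_Seq wp_Assign[where n = n])+
      apply (simp add: fits)
    apply (rule wp_Seq wp_Assign[where n = n])+
      apply (simp add: fits)
    apply (rule wp_Seq)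
    apply (rule wp_mono, rule wp_encode_set[where i = i])
    using i inv apply (simp_all add: inputD)[5]
    apply (rule wp_Store[where n = n])
    using i inv fits' by (simp_all add: less_Suc_eq algebra_simps)
next
  case (5 q t s' m')
  then show ?case
    by (simp add: coded_def algebra_simps)
qed (use assms fits in \<open>auto dest: inputD\<close>)

text \<open>Sets without \<open>j\<close> are treated as well, although the truncated subtraction
  then gives no meaningful code. The extra cells do no harm, since filling comes afterwards.\<close>

lemma wp_clear_dict:
  assumes "coded (reg s) (mem s)" "reg s 2 = j" "reg s 4 = 2 ^ j" "j < n"
  shows "wp R clear_dict (\<lambda>q t s' m'. q = 0 \<and> t \<le> (k + 1) * (14 * max_cost n) \<and>
    coded (reg s') (mem s') \<and> reg s' 2 = j \<and> reg s' 4 = 2 ^ j \<and>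
    (\<forall>p<k. mem s' 2 (set_encode (D p) - 2 ^ j) = k) \<and> m' = m) s m"
  unfolding clear_dict_def
proof (rule wp_For[where n = n and N = k and qb = 0 and tb = "6 * max_cost n" and
      I = "\<lambda>i s' m'. coded (reg s') (mem s') \<and> reg s' 2 = j \<and> reg s' 4 = 2 ^ j \<and>
        (\<forall>p<i. mem s' 2 (set_encode (D p) - 2 ^ j) = k) \<and> m' = m"], goal_cases)
  case (4 i s1 m1)
  note coded = codedD[of "reg s1" "mem s1"] inputD[of "reg s1" "mem s1"]
  have "set_encode (D i) \<le> max_word n"
    using code_fits D_subset 4 by blast
  then show ?case
    using 4 coded fits power_fits[OF assms(4)]
    by (intro wp_Store[where n = n]) (simp_all add: less_Suc_eq)
qed (use assms fits in \<open>auto dest: inputD(1-3) codedD(1)\<close>)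

lemma wp_fill_dict:
  assumes "coded (reg s) (mem s)" "reg s 2 = j" "reg s 4 = 2 ^ j"
    "\<forall>p<k. mem s 2 (set_encode (D p) - 2 ^ j) = k"
  shows "wp R fill_dict (\<lambda>q t s' m'. q = 0 \<and> t \<le> (k + 1) * (12 * max_cost n) \<and>
    coded (reg s') (mem s') \<and> reg s' 2 = j \<and> reg s' 4 = 2 ^ j \<and>
    (\<forall>i<k. j \<in> D i \<longrightarrow> mem s' 2 (set_encode (D i) - 2 ^ j) = index (D i - {j})) \<and> m' = m) s m"
  unfolding fill_dict_def
\<comment> \<open>Two clauses describe the dictionary: the first \<open>i\<close> entries are in
  place, and a cell to be looked up still holds the dummy unless it is one of them.\<close>
proof (rule wp_For[where n = n and N = k and qb = 0 and tb = "4 * max_cost n" and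
      I = "\<lambda>i s' m'. coded (reg s') (mem s') \<and> reg s' 2 = j \<and> reg s' 4 = 2 ^ j \<and>
        (\<forall>p<i. mem s' 2 (set_encode (D p)) = p) \<and>
        (\<forall>l<k. (\<forall>p<i. set_encode (D p) \<noteq> set_encode (D l) - 2 ^ j) \<longrightarrow>
           mem s' 2 (set_encode (D l) - 2 ^ j) = k) \<and> m' = m"], goal_cases)
  case (4 i s1 m1)
  note coded = codedD[of "reg s1" "mem s1"] inputD[of "reg s1" "mem s1"]
  have "set_encode (D i) \<le> max_word n"
    using code_fits D_subset 4 by blast
  \<comment> \<open>Codes are distinct, so the new entry overwrites no earlier one.\<close>
  moreover have "set_encode (D p) \<noteq> set_encode (D i)" if "p < i" for p
    using that 4 D_inj finite_D[of p] finite_D[of i]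
    by (auto simp: set_encode_eq dest: inj_onD)
  moreover have "i \<le> max_word n"
    using 4 fits by simp
  ultimately show ?case
    using 4 coded by (intro wp_Store[where n = n]) (simp_all add: less_Suc_eq)
next
  case (5 q t s' m')
  have "mem s' 2 (set_encode (D i) - 2 ^ j) = index (D i - {j})" if i: "i < k" "j \<in> D i" for i
  proof -
    \<comment> \<open>As \<open>j\<close> lies in \<open>D i\<close>, the subtraction is exact
      here.\<close>
    have code: "set_encode (D i) - 2 ^ j = set_encode (D i - {j})"
      using i finite_D[of i] by (simp add: set_encode_def sum_diff1_nat)
    have eq: "set_encode (D p) = set_encode (D i) - 2 ^ j \<longleftrightarrow> D p = D i - {j}" if "p < k" for p
      using that i finite_D[of i] finite_D[of p] by (simp add: code set_encode_eq)
    show ?thesis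
    proof (cases "\<exists>p<k. D p = D i - {j}")
      case True
      then obtain p where "p < k" "D p = D i - {j}"
        by blast
      then show ?thesis
        using 5 index_D[of p] code by metis
    next
      case False
      then show ?thesis
        using 5 index_absent[of "D i - {j}"] eq i by auto
    qed
  qed
  then show ?case
    using 5 by simp
qed (use assms fits in \<open>auto dest: inputD(1-3) codedD(1)\<close>)

text \<open>The table is updated in place: the value read when treating set \<open>i\<close> belongs to a set
  without \<open>j\<close> or to the dummy index, and is not modified during sweep \<open>j\<close>.\<close>

lemma wp_update:
  assumes "coded (reg s) (mem s)" "reg s 2 = j" "reg s 4 = 2 ^ j" "j < n"
    "\<forall>i<k. j \<in> D i \<longrightarrow> mem s 2 (set_encode (D i) - 2 ^ j) = index (D i - {j})"
    and m: "\<forall>i\<le>k. m 0 i = sweep R f v j i"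
  shows "wp R (update f) (\<lambda>q t s' m'. q \<le> k \<and> t \<le> (k + 1) * (24 * max_cost n) \<and>
    coded (reg s') (mem s') \<and> reg s' 2 = j \<and> reg s' 4 = 2 ^ j \<and>
    (\<forall>i\<le>k. m' 0 i = sweep R f v (Suc j) i)) s m"
  unfolding update_def
proof (rule wp_For[where n = n and N = k and qb = 1 and tb = "16 * max_cost n" and
      I = "\<lambda>i s' m'. coded (reg s') (mem s') \<and> reg s' 2 = j \<and> reg s' 4 = 2 ^ j \<and>
        mem s' 2 = mem s 2 \<and>
        (\<forall>p\<le>k. m' 0 p = sweep R f v (if p < i then Suc j else j) p)"], goal_cases)
  case (4 i s1 m1)
  note coded = codedD[of "reg s1" "mem s1"] inputD[of "reg s1" "mem s1"]
  have code: "set_encode (D i) \<le> max_word n"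
    using code_fits D_subset 4 by blast
  have bit: "val s1 bit_expr = of_bool (j \<in> D i)"
    using 4 assms(4) coded by (simp add: bit_expr_def)
  let ?p = "index (D i - {j})"
  have "D ?p = D i - {j} \<or> ?p = k"
    using index_cases by blast
  then have read: "m1 0 ?p = sweep R f v j ?p"
    using 4 index_le[of "D i - {j}"] by auto
  have small: "i \<le> max_word n" "j \<le> max_word n" "?p \<le> max_word n"
    using 4 assms(4) index_le[of "D i - {j}"] fits by simp_all
  show ?case
  proof (rule wp_Cond[where n = n])
    show "vals_le (max_word n) s1 bit_expr"
      using 4 coded small fits address_fits[of i j] assms(4) by (simp add: bit_expr_def)
  next
    fix t
    assume t: "t \<le> (nodes bit_expr + 1) * max_cost n" and "val s1 bit_expr \<noteq> 0"
    then have j: "j \<in> D i"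
      using bit by simp
    show "wp R (ROp f (0, Reg 3) (0, Reg 3) (0, Arr 2 (Op Sub (Arr 1 (Reg 3)) (Reg 4))))
      (\<lambda>q ta s' m'. q \<le> 1 \<and> t + ta \<le> 16 * max_cost n \<and> reg s' 3 = i \<and>
        coded (reg (s'\<lparr>reg := (reg s')(3 := Suc i)\<rparr>)) (mem (s'\<lparr>reg := (reg s')(3 := Suc i)\<rparr>)) \<and>
        reg (s'\<lparr>reg := (reg s')(3 := Suc i)\<rparr>) 2 = j \<and>
        reg (s'\<lparr>reg := (reg s')(3 := Suc i)\<rparr>) 4 = 2 ^ j \<and>
        mem (s'\<lparr>reg := (reg s')(3 := Suc i)\<rparr>) 2 = mem s 2 \<and>
        (\<forall>p\<le>k. m' 0 p = sweep R f v (if p < Suc i then Suc j else j) p)) s1 m1"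
      using 4 coded small code j t read assms(5) power_fits[OF assms(4)]
      by (intro wp_ROp[where n = n])
        (auto simp: bit_expr_def get_def put_def less_Suc_eq)
  next
    fix t
    assume "t \<le> (nodes bit_expr + 1) * max_cost n" and "val s1 bit_expr = 0"
    then show "wp R (Plain Skip)
      (\<lambda>q ta s' m'. q \<le> 1 \<and> t + ta \<le> 16 * max_cost n \<and> reg s' 3 = i \<and>
        coded (reg (s'\<lparr>reg := (reg s')(3 := Suc i)\<rparr>)) (mem (s'\<lparr>reg := (reg s')(3 := Suc i)\<rparr>)) \<and>
        reg (s'\<lparr>reg := (reg s')(3 := Suc i)\<rparr>) 2 = j \<and>
        reg (s'\<lparr>reg := (reg s')(3 := Suc i)\<rparr>) 4 = 2 ^ j \<and>
        mem (s'\<lparr>reg := (reg s')(3 := Suc i)\<rparr>) 2 = mem s 2 \<and>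
        (\<forall>p\<le>k. m' 0 p = sweep R f v (if p < Suc i then Suc j else j) p)) s1 m1"
      using 4 bit max_cost_pos[of n]
      by (intro wp_Skip) (auto simp: bit_expr_def less_Suc_eq)
  qed
next
  case (5 q t s' m')
  then show ?case
    by (auto simp: less_Suc_eq_le)
qed (use assms fits in \<open>auto dest: inputD(1-3) codedD(1)\<close>)

text \<open>Only \<open>update\<close> uses the ring, at most once per set, in each of the
  \<open>n\<close> sweeps. Entries are tracked up to \<open>k\<close> inclusive because the dummy
  cell is read too.\<close>

lemma wp_transform_loop:
  assumes "coded (reg s) (mem s)" and m: "\<forall>i\<le>k. m 0 i = v i"
  shows "wp R (transform_loop f) (\<lambda>q t s' m'. q \<le> n * k \<and>
    t \<le> (n + 1) * (k + 1) * (64 * max_cost n) \<and> (\<forall>i\<le>k. m' 0 i = sweep R f v n i)) s m"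
proof -
  let ?I = "\<lambda>j s' m'. coded (reg s') (mem s') \<and> reg s' 4 = 2 ^ j \<and>
        (\<forall>i\<le>k. m' 0 i = sweep R f v j i)"
  \<comment> \<open>Clearing, filling and updating take 14, 12 and 24 units times
    \<open>k + 1\<close>, and doubling register 4 takes 4 units.\<close>
  have step: "wp R (ASeq clear_dict (ASeq fill_dict (ASeq (update f)
       (Plain (Assign 4 (Op Mul (Const 2) (Reg 4)))))))
     (\<lambda>q t s' m'. q \<le> k \<and> t \<le> (k + 1) * (54 * max_cost n) \<and> reg s' 2 = j \<and>
        ?I (Suc j) (s'\<lparr>reg := (reg s')(2 := Suc j)\<rparr>) m') s1 m1"
    if j: "j < n" "reg s1 2 = j" "?I j s1 m1" for j s1 m1
    apply (rule wp_Seq, rule wp_mono, rule wp_clear_dict)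
    using j apply simp_all[4]
    apply (elim conjE, rule wp_Seq, rule wp_mono, rule wp_fill_dict)
        apply assumption+
    apply (elim conjE, rule wp_Seq, rule wp_mono, rule wp_update[where v = v])
          apply assumption+
    using j(1) apply assumption
      apply assumption
    using j(3) apply (simp del: sweep.simps)
    apply (elim conjE, rule wp_Assign[where n = n])
    using fits power_fits[OF j(1)]
    by (simp_all add: algebra_simps del: sweep.simps)
  show ?thesis
    unfolding transform_loop_def
  proof (rule wp_Seq, rule wp_Assign[where n = n], goal_cases)
    case 1
    show ?case
      using fits by simp
  next
    case (2 t)
    show ?case
    proof (rule wp_For[where n = n and N = n and qb = k and tb = "(k + 1) * (54 * max_cost n)"
          and I = ?I], goal_cases)
      case (4 j s1 m1)
      then show ?case
        using step[of j s1 m1] by blast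
    next
      case (5 q t' s' m')
      then show ?case
        using 2 by (simp add: algebra_simps)
    qed (use assms fits in \<open>auto dest: inputD(1-3) codedD(1)\<close>)
  qed
qed

end

subsection \<open>Partial transforms of a convex family\<close>

text \<open>For \<open>S\<close> in \<open>F\<close> this interpolates between the table entry at
  \<open>V = {}\<close> and the full transform once \<open>V\<close> contains
  \<open>S\<close>.\<close>

definition partial_transform ::
  "('r, 'm) ring_scheme \<Rightarrow> 'r \<Rightarrow> 'u set set \<Rightarrow> ('u set \<Rightarrow> 'r) \<Rightarrow> 'u set \<Rightarrow> 'u set \<Rightarrow> 'r" where
  "partial_transform R e F A V S =
     (\<Oplus>\<^bsub>R\<^esub>T\<in>{T \<in> F. T \<subseteq> S \<and> S - T \<subseteq> V}. e [^]\<^bsub>R\<^esub> card (S - T) \<otimes>\<^bsub>R\<^esub> A T)"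

context cring
begin

context
  fixes e :: 'a and F :: "'u set set" and A :: "'u set \<Rightarrow> 'a"
  assumes e: "e \<in> carrier R" and F: "finite F" and A: "A \<in> F \<rightarrow> carrier R"
begin

lemma partial_transform_closed: "partial_transform R e F A V S \<in> carrier R"
  unfolding partial_transform_def using A e by (intro finsum_closed) auto

lemma partial_transform_empty:
  assumes "S \<in> F"
  shows "partial_transform R e F A {} S = A S"
proof -
  have "{T \<in> F. T \<subseteq> S \<and> S - T \<subseteq> {}} = {S}"
    using assms by auto
  moreover have "A S \<in> carrier R"
    using A assms by auto
  ultimately show ?thesis
    by (simp add: partial_transform_def finsum_insert)
qed

text \<open>Split the sum by whether \<open>T\<close> contains \<open>u\<close>. If it does, then
  \<open>u\<close> is not in \<open>S - T\<close> and the old condition on \<open>V\<close> applies.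
  Otherwise \<open>T\<close> lies below \<open>S - {u}\<close>, and \<open>S - T\<close> has one
  element more than \<open>S - {u} - T\<close>, which contributes the factor
  \<open>e\<close>.\<close>

lemma partial_transform_insert:
  assumes "u \<in> S" "u \<notin> V" "finite S"
  shows "partial_transform R e F A (insert u V) S =
    partial_transform R e F A V S \<oplus> e \<otimes> partial_transform R e F A V (S - {u})"
proof -
  let ?w = "\<lambda>S T. e [^] card (S - T) \<otimes> A T"
  let ?B = "{T \<in> F. T \<subseteq> S \<and> S - T \<subseteq> V}"
  let ?C = "{T \<in> F. T \<subseteq> S - {u} \<and> S - {u} - T \<subseteq> V}"
  have closed: "?w S T \<in> carrier R" if "T \<in> F" for S T
    using that A e by auto
  have pow: "?w S T = e \<otimes> ?w (S - {u}) T" if "T \<in> ?C" for T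
  proof -
    have "S - T = insert u (S - {u} - T)"
      using that assms(1) by auto
    then have "card (S - T) = Suc (card (S - {u} - T))"
      using assms(3) by simp
    moreover have "A T \<in> carrier R"
      using that A by auto
    ultimately show ?thesis
      using e by (simp add: m_ac)
  qed
  have "{T \<in> F. T \<subseteq> S \<and> S - T \<subseteq> insert u V} = ?B \<union> ?C"
    using assms(1,2) by auto
  then have "partial_transform R e F A (insert u V) S = finsum R (?w S) (?B \<union> ?C)"
    by (simp add: partial_transform_def)
  also have "\<dots> = finsum R (?w S) ?B \<oplus> finsum R (?w S) ?C"
    using F closed assms(1,2) by (intro finsum_Un_disjoint) auto
  also have "finsum R (?w S) ?C = finsum R (\<lambda>T. e \<otimes> ?w (S - {u}) T) ?C"
    using pow closed e by (intro finsum_cong') auto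
  also have "\<dots> = e \<otimes> finsum R (?w (S - {u})) ?C"
    using F e closed by (intro finsum_rdistr[symmetric]) auto
  finally show ?thesis
    by (simp add: partial_transform_def)
qed

end

end

lemma partial_transform_insert_notin:
  assumes "u \<notin> S"
  shows "partial_transform R e F A (insert u V) S = partial_transform R e F A V S"
proof -
  have "{T \<in> F. T \<subseteq> S \<and> S - T \<subseteq> insert u V} = {T \<in> F. T \<subseteq> S \<and> S - T \<subseteq> V}"
    using assms by auto
  then show ?thesis
    by (simp add: partial_transform_def)
qed

text \<open>This is where convexity enters: a member of \<open>F\<close> below \<open>S\<close> avoiding \<open>u\<close> would force
  \<open>S - {u}\<close> to be a member as well.\<close>

lemma partial_transform_insert_absent:
  assumes convex: "\<And>T X. T \<in> F \<Longrightarrow> T \<subseteq> X \<Longrightarrow> X \<subseteq> S \<Longrightarrow> X \<in> F" and "S - {u} \<notin> F"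
  shows "partial_transform R e F A (insert u V) S = partial_transform R e F A V S"
proof -
  have "u \<in> T" if "T \<in> F" "T \<subseteq> S" for T
    using that convex[of T "S - {u}"] assms(2) by blast
  then have "{T \<in> F. T \<subseteq> S \<and> S - T \<subseteq> insert u V} = {T \<in> F. T \<subseteq> S \<and> S - T \<subseteq> V}"
    by auto
  then show ?thesis
    by (simp add: partial_transform_def)
qed

lemma partial_transform_full:
  assumes "S \<subseteq> V"
  shows "partial_transform R e F A V S =
    (\<Oplus>\<^bsub>R\<^esub>T\<in>{T \<in> F. T \<subseteq> S}. e [^]\<^bsub>R\<^esub> card (S - T) \<otimes>\<^bsub>R\<^esub> A T)"
proof -
  have "{T \<in> F. T \<subseteq> S \<and> S - T \<subseteq> V} = {T \<in> F. T \<subseteq> S}"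
    using assms by auto
  then show ?thesis
    by (simp add: partial_transform_def)
qed

lemma moebius_eq_partial_transform:
  "S \<subseteq> V \<Longrightarrow> moebius R F A S = partial_transform R (\<ominus>\<^bsub>R\<^esub> \<one>\<^bsub>R\<^esub>) F A V S"
  by (simp add: moebius_def partial_transform_full)

lemma (in cring) zeta_eq_partial_transform:
  assumes "S \<subseteq> V" "A \<in> F \<rightarrow> carrier R"
  shows "zeta R F A S = partial_transform R \<one> F A V S"
  unfolding zeta_def partial_transform_full[OF assms(1)]
  using assms(2) by (intro finsum_cong') (auto simp: Pi_iff)


subsection \<open>Positions and the listing\<close>

definition positions :: "'u list \<Rightarrow> 'u set \<Rightarrow> nat set" where
  "positions us S = {j. j < length us \<and> us ! j \<in> S}"

lemma mem_positions [simp]: "j < length us \<Longrightarrow> j \<in> positions us S \<longleftrightarrow> us ! j \<in> S"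
  by (simp add: positions_def)

lemma inj_on_bitstring: "inj_on (bitstring us) (Pow (set us))"
  by (rule inj_onI) (auto simp: bitstring_def)

lemma inj_on_positions: "inj_on (positions us) (Pow (set us))"
proof (rule inj_on_inverseI[where g = "(`) ((!) us)"])
  show "(!) us ` positions us S = S" if "S \<in> Pow (set us)" for S
    using that by (fastforce simp: positions_def in_set_conv_nth)
qed

lemma positions_Diff:
  assumes "distinct us" "j < length us"
  shows "positions us (S - {us ! j}) = positions us S - {j}"
  using assms by (auto simp: positions_def nth_eq_iff_index_eq)

text \<open>An injective key makes the order of insertion immaterial, as the fold behind sorting
  requires; the key of a listing is \<open>bitstring us\<close>.\<close>

lemma (in linorder) sorted_key_list_of_set_inj_on:
  assumes "inj_on f F" "finite F"
  shows "set (sorted_key_list_of_set f F) = F" "distinct (sorted_key_list_of_set f F)"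
    "length (sorted_key_list_of_set f F) = card F"
proof -
  interpret folding_insort_key "(\<le>)" "(<)" F f
    using assms(1) by unfold_locales
  show "set (sorted_key_list_of_set f F) = F" "distinct (sorted_key_list_of_set f F)"
    "length (sorted_key_list_of_set f F) = card F"
    using assms(2) distinct_sorted_key_list_of_set[of F] by (simp_all add: distinct_map)
qed

lemma
  assumes "F \<subseteq> Pow (set us)"
  shows set_listing: "set (listing us F) = F"
    and distinct_listing: "distinct (listing us F)"
    and length_listing: "length (listing us F) = card F"
proof -
  have "inj_on (bitstring us) F" "finite F"
    using inj_on_subset[OF inj_on_bitstring assms] finite_subset[OF assms] by simp_all
  then show "set (listing us F) = F" "distinct (listing us F)" "length (listing us F) = card F"
    by (simp_all add: listing_def sorted_key_list_of_set_inj_on)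
qed

lemma nth_take_insert: "j < length us \<Longrightarrow> set (take (Suc j) us) = insert (us ! j) (set (take j us))"
  by (simp add: take_Suc_conv_app_nth)

lemma nth_notin_take: "distinct us \<Longrightarrow> j < length us \<Longrightarrow> us ! j \<notin> set (take j us)"
  by (auto simp: in_set_conv_nth nth_eq_iff_index_eq)


subsection \<open>Correctness and running time\<close>

text \<open>Closure differences enter the correctness proof through this interval property.\<close>

locale convex_family =
  fixes us :: "'u list" and F :: "'u set set"
  assumes distinct: "distinct us"
    and subset: "F \<subseteq> Pow (set us)"
    and convex: "T \<in> F \<Longrightarrow> S \<in> F \<Longrightarrow> T \<subseteq> X \<Longrightarrow> X \<subseteq> S \<Longrightarrow> X \<in> F"
begin

abbreviation "xs \<equiv> listing us F"

abbreviation "family_index i \<equiv> positions us (xs ! i)"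

lemma nth_in: "i < card F \<Longrightarrow> xs ! i \<in> F"
  using set_listing[OF subset] length_listing[OF subset] nth_mem by metis

lemma finite_F: "finite F"
  using subset finite_subset by auto

sublocale indexed_family "length us" "card F" family_index
proof
  show "family_index i \<subseteq> {..<length us}" for i
    by (auto simp: positions_def)
  have "inj_on ((!) xs) {..<card F}"
    using distinct_listing[OF subset] length_listing[OF subset]
    by (auto simp: inj_on_def nth_eq_iff_index_eq)
  moreover have "inj_on (positions us) ((!) xs ` {..<card F})"
    using inj_on_positions by (rule inj_on_subset) (use nth_in subset in blast)
  ultimately show "inj_on family_index {..<card F}"
    using comp_inj_on[of "(!) xs" _ "positions us"] by (simp add: comp_def)
qed

lemma index_Diff_member:
  assumes "i < card F" "j < length us" "xs ! i - {us ! j} \<in> F"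
  shows "index (family_index i - {j}) < card F"
    "xs ! index (family_index i - {j}) = xs ! i - {us ! j}"
proof -
  obtain p where p: "p < card F" "xs ! p = xs ! i - {us ! j}"
    using assms(3) set_listing[OF subset] length_listing[OF subset] by (metis in_set_conv_nth)
  then have "index (family_index i - {j}) = p"
    using index_D[of p] positions_Diff[OF distinct assms(2)] by metis
  with p show "index (family_index i - {j}) < card F"
    "xs ! index (family_index i - {j}) = xs ! i - {us ! j}"
    by simp_all
qed

lemma index_Diff_absent:
  assumes "i < card F" "j < length us" "xs ! i - {us ! j} \<notin> F"
  shows "index (family_index i - {j}) = card F"
proof (rule index_absent)
  fix p
  assume p: "p < card F"
  have "xs ! i - {us ! j} \<subseteq> set us" "xs ! p \<subseteq> set us" "xs ! p \<noteq> xs ! i - {us ! j}"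
    using nth_in[OF p] nth_in[OF assms(1)] subset assms(3) by auto
  then show "family_index p \<noteq> family_index i - {j}"
    using inj_on_positions[of us] positions_Diff[OF distinct assms(2), symmetric]
    by (auto dest: inj_onD)
qed

text \<open>Induction on the sweeps links the machine view to the partial sums. Assumption
  \<open>op\<close> covers addition with \<open>e = 1\<close> and subtraction with
  \<open>e = -1\<close>.\<close>

lemma sweep_eq_partial_transform:
  fixes R :: "('r, 'm) ring_scheme"
  assumes R: "cring R" and e: "e \<in> carrier R" and A: "A \<in> F \<rightarrow> carrier R"
    and op: "\<And>x y. x \<in> carrier R \<Longrightarrow> y \<in> carrier R \<Longrightarrow>
      apply_rop R f x y = x \<oplus>\<^bsub>R\<^esub> e \<otimes>\<^bsub>R\<^esub> y"
    and v: "v = (\<lambda>i. if i < card F then A (xs ! i) else \<zero>\<^bsub>R\<^esub>)"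
    and "j \<le> length us" "i \<le> card F"
  shows "sweep R f v j i = (if i < card F
    then partial_transform R e F A (set (take j us)) (xs ! i) else \<zero>\<^bsub>R\<^esub>)"
  using assms(6,7)
proof (induction j arbitrary: i)
  case 0
  interpret cring R by (rule R)
  show ?case
    using partial_transform_empty[OF e finite_F A nth_in] by (simp add: v)
next
  case (Suc j)
  interpret cring R by (rule R)
  let ?P = "partial_transform R e F A"
  have j: "j < length us"
    using Suc.prems by simp
  note closed = partial_transform_closed[OF e finite_F A]
  show ?case
  proof (cases "i < card F \<and> j \<in> family_index i")
    case False
    then show ?thesis
      using Suc j by (auto simp: nth_take_insert partial_transform_insert_notin)
  next
    case True
    let ?p = "index (family_index i - {j})"
    have i: "xs ! i \<in> F" "us ! j \<in> xs ! i"
      using True nth_in j by auto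
    have IH: "sweep R f v j i = ?P (set (take j us)) (xs ! i)"
      "sweep R f v j ?p = (if ?p < card F then ?P (set (take j us)) (xs ! ?p) else \<zero>\<^bsub>R\<^esub>)"
      using Suc.IH j True index_le by auto
    show ?thesis
    proof (cases "xs ! i - {us ! j} \<in> F")
      case member: True
      have "finite (xs ! i)"
        using i subset finite_subset by blast
      note ins = partial_transform_insert[OF e finite_F A i(2) nth_notin_take[OF distinct j] this]
      show ?thesis
        using True IH index_Diff_member[OF _ j member]
        by (simp add: op closed ins nth_take_insert[OF j])
    next
      \<comment> \<open>The lookup yields the dummy index, whose entry is zero, so the ring
        operation leaves the value unchanged; by convexity so does enlarging
        \<open>V\<close>.\<close>
      case absent: False
      have ins: "?P (insert (us ! j) (set (take j us))) (xs ! i) = ?P (set (take j us)) (xs ! i)"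
        by (rule partial_transform_insert_absent[OF _ absent]) (rule convex[OF _ i(1)])
      show ?thesis
        using True IH index_Diff_absent[OF _ j absent] e
        by (simp add: op closed ins nth_take_insert[OF j])
    qed
  qed
qed

end

text \<open>Here \<open>n + 1\<close>, \<open>k + 1\<close> and \<open>2 * n + 3\<close> are at most
  2, 2 and 5 times the respective maxima, and \<open>2040 = 102 * 20\<close>. The two factors
  depending on \<open>n\<close> raise the exponent by 2.\<close>

lemma time_bound:
  "a * max 1 k * max 1 n ^ b + 102 * ((n + 1) * (k + 1) * max_cost n)
    \<le> (a + 2040) * max 1 k * max 1 n ^ (b + 2)"
proof -
  let ?k = "max 1 k" and ?n = "max 1 n"
  have "(n + 1) * (k + 1) * max_cost n \<le> (2 * ?n) * (2 * ?k) * (5 * ?n)"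
    unfolding max_cost_def by (intro mult_mono) auto
  also have "\<dots> = 20 * ?k * ?n ^ 2"
    by (simp add: power2_eq_square)
  also have "\<dots> \<le> 20 * ?k * ?n ^ (b + 2)"
    by (intro mult_left_mono power_increasing) auto
  finally have "102 * ((n + 1) * (k + 1) * max_cost n) \<le> 2040 * ?k * ?n ^ (b + 2)"
    by simp
  moreover have "a * ?k * ?n ^ b \<le> a * ?k * ?n ^ (b + 2)"
    by (intro mult_left_mono power_increasing) auto
  ultimately show ?thesis
    unfolding add_mult_distrib by linarith
qed

text \<open>Both transforms run the same program up to the operation \<open>f\<close>. Its text
  depends on neither instance nor ring, while \<open>e\<close> must be chosen within each
  ring.\<close>

lemma transform_computableI:
  fixes us :: "bool list \<Rightarrow> 'u list"
    and transform :: "'r ring \<Rightarrow> 'u set set \<Rightarrow> ('u set \<Rightarrow> 'r) \<Rightarrow> 'u set \<Rightarrow> 'r"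
  assumes family: "\<And>x. x \<in> X \<Longrightarrow> convex_family (us x) (F x)"
    and listable: "efficiently_listable X us F"
    and e: "\<And>R :: 'r ring. cring R \<Longrightarrow> e R \<in> carrier R"
    and op: "\<And>R :: 'r ring. \<And>y z. cring R \<Longrightarrow> y \<in> carrier R \<Longrightarrow> z \<in> carrier R \<Longrightarrow>
      apply_rop R f y z = y \<oplus>\<^bsub>R\<^esub> e R \<otimes>\<^bsub>R\<^esub> z"
    and transform: "\<And>(R :: 'r ring) G A S V. cring R \<Longrightarrow> A \<in> G \<rightarrow> carrier R \<Longrightarrow> S \<subseteq> V \<Longrightarrow>
      transform R G A S = partial_transform R (e R) G A V S"
  shows "transform_computable X us F transform"
proof -
  obtain L a b where L: "\<And>x. x \<in> X \<Longrightarrow> \<exists>t s. exec L (input_state (length (us x)) x) t s \<and>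
      outputs_bitstrings s (length (us x)) (map (bitstring (us x)) (listing (us x) (F x))) \<and>
      t \<le> ostar_bound a b (set (us x)) (F x)"
    using listable unfolding efficiently_listable_def by blast
  let ?P = "ASeq (Plain L) (ASeq encode_sets (transform_loop f))"
  have "\<exists>q t s m.
      aexec R ?P (input_state (length (us x)) x, input_rmem R (table (us x) (F x) A)) q t (s, m) \<and>
      outputs_table m (table (us x) (F x) (transform R (F x) A)) \<and>
      q \<le> 1 * (card (F x) * card (set (us x))) \<and>
      t \<le> ostar_bound (a + 2040) (b + 2) (set (us x)) (F x)"
    if x: "x \<in> X" and R: "cring R" and A: "A \<in> F x \<rightarrow> carrier R" for x A and R :: "'r ring"
  proof -
    interpret convex_family "us x" "F x"
      by (rule family[OF x])
    let ?n = "length (us x)" and ?k = "card (F x)"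
    let ?m = "input_rmem R (table (us x) (F x) A)"
    let ?v = "\<lambda>i. if i < ?k then A (xs ! i) else \<zero>\<^bsub>R\<^esub>"
    note len = length_listing[OF subset]
    obtain t s where s: "exec L (input_state ?n x) t s"
      "outputs_bitstrings s ?n (map (bitstring (us x)) xs)"
      "t \<le> ostar_bound a b (set (us x)) (F x)"
      using L[OF x] by blast
    have start: "input (reg s) (mem s)"
      using s(2) len
      by (auto simp: outputs_bitstrings_def input_def bitstring_def)
    have table: "?m 0 i = ?v i" for i
      using len by (simp add: input_rmem_def table_def)
    \<comment> \<open>The listing program leaves ring memory untouched; encoding and sweeps
      contribute \<open>38 + 64 = 102\<close> units per \<open>(n + 1) * (k + 1)\<close>.\<close>
    have "wp R ?P (\<lambda>q t s' m'. q \<le> ?n * ?k \<and>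
        t \<le> ostar_bound a b (set (us x)) (F x) + 102 * ((?n + 1) * (?k + 1) * max_cost ?n) \<and>
        (\<forall>i\<le>?k. m' 0 i = sweep R f ?v ?n i)) (input_state ?n x) ?m"
      apply (rule wp_Seq, rule wp_Plain, rule s(1))
      apply (rule wp_Seq, rule wp_mono, rule wp_encode_sets, rule start)
      apply (elim conjE, rule wp_mono, rule wp_transform_loop[where v = ?v], assumption)
      using table s(3) by auto
    then obtain q t' s' m' where run:
      "aexec R ?P (input_state ?n x, ?m) q t' (s', m')" "q \<le> ?n * ?k"
      "t' \<le> ostar_bound a b (set (us x)) (F x) + 102 * ((?n + 1) * (?k + 1) * max_cost ?n)"
      "\<forall>i\<le>?k. m' 0 i = sweep R f ?v ?n i"
      unfolding wp_def by blast
    have result: "sweep R f ?v ?n i = transform R (F x) A (xs ! i)" if i: "i < ?k" for i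
    proof -
      have "xs ! i \<subseteq> set (us x)"
        using nth_in[OF i] subset by blast
      then show ?thesis
        using sweep_eq_partial_transform[OF R e[OF R] A op[OF R] refl, of ?n i]
          transform[OF R A, of "xs ! i" "set (us x)"] i by simp
    qed
    have "outputs_table m' (table (us x) (F x) (transform R (F x) A))"
      using run(4) result len by (simp add: outputs_table_def table_def)
    moreover have "q \<le> 1 * (?k * card (set (us x)))"
      using run(2) distinct_card[OF distinct] by (simp add: mult.commute)
    moreover have "t' \<le> ostar_bound (a + 2040) (b + 2) (set (us x)) (F x)"
      using run(3) time_bound[of a ?k ?n b]
      unfolding ostar_bound_def distinct_card[OF distinct] by (rule order_trans)
    ultimately show ?thesis
      using run(1) by blast
  qed
  then show ?thesis
    unfolding transform_computable_def by blast
qed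

text \<open>Up-closures are upward closed within \<open>U\<close>: \<open>X\<close> inherits
  membership in the first from \<open>T\<close>, and if it were in the second, so would be
  \<open>S\<close>.\<close>

lemma convex_closure_difference:
  assumes "T \<in> up_closure U G - up_closure U H" "S \<in> up_closure U G - up_closure U H"
    "T \<subseteq> X" "X \<subseteq> S"
  shows "X \<in> up_closure U G - up_closure U H"
proof -
  have up: "Z \<in> up_closure U K" if "Y \<in> up_closure U K" "Y \<subseteq> Z" "Z \<subseteq> U" for K Y Z
    using that unfolding up_closure_def by simp (meson order_trans)
  have "S \<subseteq> U"
    using assms(2) by (simp add: up_closure_def)
  then show ?thesis
    using up[of T G X] up[of X H S] assms by auto
qed

theorem theorem48:
  fixes X :: "bool list set"
    and us :: "bool list \<Rightarrow> 'u list"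
    and Fplus Fminus F :: "bool list \<Rightarrow> 'u set set"
  assumes universe: "\<And>x. x \<in> X \<Longrightarrow> distinct (us x)"
    and subsets: "\<And>x. x \<in> X \<Longrightarrow> Fplus x \<subseteq> Pow (set (us x)) \<and> Fminus x \<subseteq> Pow (set (us x))"
    and closure_difference: "\<And>x. x \<in> X \<Longrightarrow>
      F x = up_closure (set (us x)) (Fplus x) - up_closure (set (us x)) (Fminus x)"
    and listable: "efficiently_listable X us F"
  shows "transform_computable X us F
           (zeta :: 'r ring \<Rightarrow> 'u set set \<Rightarrow> ('u set \<Rightarrow> 'r) \<Rightarrow> 'u set \<Rightarrow> 'r)
       \<and> transform_computable X us F
           (moebius :: 'r ring \<Rightarrow> 'u set set \<Rightarrow> ('u set \<Rightarrow> 'r) \<Rightarrow> 'u set \<Rightarrow> 'r)"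
proof
  have family: "convex_family (us x) (F x)" if "x \<in> X" for x
  proof
    show "F x \<subseteq> Pow (set (us x))"
      using closure_difference[OF that] by (auto simp: up_closure_def)
    show "Y \<in> F x" if "T \<in> F x" "S \<in> F x" "T \<subseteq> Y" "Y \<subseteq> S" for T S Y
      using that unfolding closure_difference[OF \<open>x \<in> X\<close>] by (rule convex_closure_difference)
  qed (rule universe[OF that])
  show "transform_computable X us F
      (zeta :: 'r ring \<Rightarrow> 'u set set \<Rightarrow> ('u set \<Rightarrow> 'r) \<Rightarrow> 'u set \<Rightarrow> 'r)"
  proof (rule transform_computableI[OF family listable, where e = "\<lambda>R. \<one>\<^bsub>R\<^esub>" and f = RAdd])
    fix R :: "'r ring"
    assume "cring R"
    then interpret cring R .
    show "\<one>\<^bsub>R\<^esub> \<in> carrier R"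
      by simp
    show "y \<in> carrier R \<Longrightarrow> z \<in> carrier R \<Longrightarrow> apply_rop R RAdd y z = y \<oplus>\<^bsub>R\<^esub> \<one>\<^bsub>R\<^esub> \<otimes>\<^bsub>R\<^esub> z" for y z
      by simp
    show "A \<in> G \<rightarrow> carrier R \<Longrightarrow> S \<subseteq> V \<Longrightarrow>
        zeta R G A S = partial_transform R \<one>\<^bsub>R\<^esub> G A V S" for G A and S V :: "'u set"
      by (rule zeta_eq_partial_transform)
  qed
  show "transform_computable X us F
      (moebius :: 'r ring \<Rightarrow> 'u set set \<Rightarrow> ('u set \<Rightarrow> 'r) \<Rightarrow> 'u set \<Rightarrow> 'r)"
  \<comment> \<open>Subtraction absorbs the sign, so a single ring operation still suffices for each
    set and element.\<close>
  proof (rule transform_computableI[OF family listable,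
        where e = "\<lambda>R. \<ominus>\<^bsub>R\<^esub> \<one>\<^bsub>R\<^esub>" and f = RSub])
    fix R :: "'r ring"
    assume "cring R"
    then interpret cring R .
    show "\<ominus>\<^bsub>R\<^esub> \<one>\<^bsub>R\<^esub> \<in> carrier R"
      by simp
    show "y \<in> carrier R \<Longrightarrow> z \<in> carrier R \<Longrightarrow>
        apply_rop R RSub y z = y \<oplus>\<^bsub>R\<^esub> (\<ominus>\<^bsub>R\<^esub> \<one>\<^bsub>R\<^esub>) \<otimes>\<^bsub>R\<^esub> z" for y z
      by (simp add: minus_eq l_minus)
    show "A \<in> G \<rightarrow> carrier R \<Longrightarrow> S \<subseteq> V \<Longrightarrow>
        moebius R G A S = partial_transform R (\<ominus>\<^bsub>R\<^esub> \<one>\<^bsub>R\<^esub>) G A V S" for G A and S V :: "'u set"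
      by (rule moebius_eq_partial_transform)
  qed
qed

end
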